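(* If $A\subseteq\Sigma^\ast$ is an $\mathrm{F_{PR}}$-rankable co-r.e. set that has an infinite recursively enumerable subset, then $A$ is recursive.
   Context: $\Sigma=\{0,1\}$, with $\Sigma^\ast$ ordered by length then lexicographically. A set is co-r.e. if its complement is recursively enumerable. $\mathrm{F_{PR}}$ is the class of partial recursive functions $\Sigma^\ast\to\Sigma^\ast$. A (possibly partial) function $f$ is a ranking function for $A$ if $f$ is defined on all of $A$ and for every $x\in A$, if $x$ is the $i$th element of $A$ then $f(x)$ is the $i$th string of $\Sigma^\ast$ (no condition outside $A$). $A$ is $\mathrm{F_{PR}}$-rankable if it has a ranking function in $\mathrm{F_{PR}}$. *)

theory Defs
  imports Main "HOL-Library.List_Lenlexorder"
begin

text \<open>
  Strings over \<open>{0,1}\<close> are lists of booleans, with \<open>False\<close> as 0, \<open>True\<close> as 1 and the head of the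
  list as the leftmost symbol.  The imported order on lists compares first the lengths and then
  lexicographically.
\<close>

type_synonym str = "bool list"


subsection \<open>Partial recursive functions on the natural numbers\<close>

definition comp_op ::
  "(nat list \<Rightarrow> nat option) \<Rightarrow> (nat list \<Rightarrow> nat option) list \<Rightarrow> nat list \<Rightarrow> nat option" where
  "comp_op f gs xs = Option.bind (those (map (\<lambda>g. g xs) gs)) f"

primrec prim_op ::
  "(nat list \<Rightarrow> nat option) \<Rightarrow> (nat list \<Rightarrow> nat option) \<Rightarrow> nat \<Rightarrow> nat list \<Rightarrow> nat option" where
  "prim_op f g 0 xs = f xs"
| "prim_op f g (Suc k) xs = Option.bind (prim_op f g k xs) (\<lambda>r. g (k # r # xs))"

text \<open>
  Unbounded search diverges if a value of \<open>f\<close> needed before the first zero is undefined.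
\<close>

definition mu_op :: "(nat list \<Rightarrow> nat option) \<Rightarrow> nat list \<Rightarrow> nat option" where
  "mu_op f xs =
    (if \<exists>y. f (y # xs) = Some 0 \<and> (\<forall>z<y. f (z # xs) \<noteq> None)
     then Some (LEAST y. f (y # xs) = Some 0) else None)"

text \<open>
  \<open>partial_recursive n f\<close>: on argument lists of length \<open>n\<close>, \<open>f\<close> is an \<open>n\<close>-ary partial recursive
  function; its values on lists of other lengths are irrelevant, which is what the last rule says.
\<close>

inductive partial_recursive :: "nat \<Rightarrow> (nat list \<Rightarrow> nat option) \<Rightarrow> bool" where
  zero: "partial_recursive n (\<lambda>xs. Some 0)"
| succ: "partial_recursive 1 (\<lambda>xs. Some (Suc (hd xs)))"
| proj: "i < n \<Longrightarrow> partial_recursive n (\<lambda>xs. Some (xs ! i))"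
| comp: "partial_recursive (length gs) f \<Longrightarrow> \<forall>g\<in>set gs. partial_recursive n g \<Longrightarrow>
    partial_recursive n (comp_op f gs)"
| prim: "partial_recursive n f \<Longrightarrow> partial_recursive (Suc (Suc n)) g \<Longrightarrow>
    partial_recursive (Suc n) (\<lambda>xs. prim_op f g (hd xs) (tl xs))"
| mu: "partial_recursive (Suc n) f \<Longrightarrow> partial_recursive n (mu_op f)"
| ext: "partial_recursive n f \<Longrightarrow> (\<And>xs. length xs = n \<Longrightarrow> g xs = f xs) \<Longrightarrow>
    partial_recursive n g"


subsection \<open>Partial recursive functions on strings\<close>

text \<open>
  The standard effective numbering of the strings in increasing order (bijective base 2):
  the empty string is 0, "0" is 1, "1" is 2, "00" is 3, and so on.
\<close>

primrec str_code :: "str \<Rightarrow> nat" where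
  "str_code [] = 0"
| "str_code (b # w) = (if b then 2 else 1) * 2 ^ length w + str_code w"

lemma str_code_bounds: "2 ^ length w \<le> Suc (str_code w)" "Suc (str_code w) < 2 ^ Suc (length w)"
  by (induction w) auto

lemma str_code_mono:
  assumes "v < w"
  shows "str_code v < str_code w"
  using assms
proof (induction v arbitrary: w)
  case Nil
  then show ?case by (cases w) auto
next
  case (Cons a v)
  obtain b u where w: "w = b # u" using Cons.prems by (cases w) auto
  from Cons.prems[unfolded w Cons_less_Cons] show ?case
  proof (elim disjE conjE)
    assume "length v < length u"
    then have "(2::nat) ^ Suc (length (a # v)) \<le> 2 ^ length w"
      by (intro power_increasing) (auto simp: w)
    then show ?thesis
      using str_code_bounds(2)[of "a # v"] str_code_bounds(1)[of w] by linarith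
  next
    assume "length v = length u" "a < b"
    then show ?thesis
      using str_code_bounds(2)[of v] str_code_bounds(1)[of u] by (simp add: w)
  next
    assume "length v = length u" "a = b" "v < u"
    then show ?thesis using Cons.IH by (simp add: w)
  qed
qed

lemma str_code_less_iff: "str_code v < str_code w \<longleftrightarrow> v < w"
  by (metis less_asym linorder_neqE str_code_mono)

lemma inj_str_code: "inj str_code"
  by (metis injI less_irrefl linorder_neqE str_code_mono)

lemma surj_str_code: "surj str_code"
proof -
  have "\<exists>w. length w = k \<and> str_code w = n" if "2 ^ k \<le> Suc n" "Suc n < 2 ^ Suc k" for k n
    using that
  proof (induction k arbitrary: n)
    case 0
    then show ?case by simp
  next
    case (Suc k)
    define b where "b \<longleftrightarrow> 3 * 2 ^ k \<le> Suc n"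
    define m where "m = n - (if b then 2 else 1) * 2 ^ k"
    have k: "(1::nat) \<le> 2 ^ k" by simp
    have n: "n = (if b then 2 else 1) * 2 ^ k + m"
      using Suc.prems k by (auto simp: m_def b_def)
    have "2 ^ k \<le> Suc m" "Suc m < 2 ^ Suc k"
      using Suc.prems k by (auto simp: m_def b_def)
    from Suc.IH[OF this] obtain w where "length w = k" "str_code w = m" by blast
    then have "length (b # w) = Suc k \<and> str_code (b # w) = n" using n by simp
    then show ?case by blast
  qed
  moreover have "\<exists>k. 2 ^ k \<le> Suc n \<and> Suc n < 2 ^ Suc k" for n :: nat
    using ex_power_ivl1[of 2 "Suc n"] by auto
  ultimately show ?thesis by (metis surjI surj_def)
qed

definition F_PR :: "(str \<rightharpoonup> str) set" where
  "F_PR = {f. \<exists>g. partial_recursive 1 g \<and> (\<forall>w. map_option str_code (f w) = g [str_code w])}"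


subsection \<open>Recursive, r.e. and co-r.e. sets\<close>

definition recursive_set :: "str set \<Rightarrow> bool" where
  "recursive_set A \<longleftrightarrow> (\<lambda>w. Some (if w \<in> A then [True] else [False])) \<in> F_PR"

text \<open>Recursively enumerable: empty, or enumerated by a total recursive function.\<close>

definition re_set :: "str set \<Rightarrow> bool" where
  "re_set A \<longleftrightarrow> A = {} \<or> (\<exists>e. (\<lambda>w. Some (e w)) \<in> F_PR \<and> A = range e)"

definition co_re_set :: "str set \<Rightarrow> bool" where
  "co_re_set A \<longleftrightarrow> re_set (- A)"


subsection \<open>Ranking functions\<close>

text \<open>Elements are counted from 1.\<close>

definition is_nth_elem :: "str set \<Rightarrow> nat \<Rightarrow> str \<Rightarrow> bool" where
  "is_nth_elem A i x \<longleftrightarrow> x \<in> A \<and> card {y \<in> A. y \<le> x} = i"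

definition ranking_function :: "(str \<rightharpoonup> str) \<Rightarrow> str set \<Rightarrow> bool" where
  "ranking_function f A \<longleftrightarrow>
    A \<subseteq> dom f \<and> (\<forall>x\<in>A. \<forall>i. is_nth_elem A i x \<longrightarrow> is_nth_elem UNIV i (the (f x)))"

definition rankable :: "(str \<rightharpoonup> str) set \<Rightarrow> str set \<Rightarrow> bool" where
  "rankable F A \<longleftrightarrow> (\<exists>f\<in>F. ranking_function f A)"

end

theory Submission
  imports Defs
begin

text \<open>
  To decide \<open>x \<in> A\<close>, search the infinite r.e. subset for an element \<open>b > x\<close>.  Since \<open>b \<in> A\<close>, the
  ranking function converges at \<open>b\<close> and reveals how many elements of \<open>A\<close>, hence how many
  non-elements, lie below \<open>b\<close>.  Enumerate the complement of \<open>A\<close> until that many non-elements below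
  \<open>b\<close> have appeared; then \<open>x \<in> A\<close> iff \<open>x\<close> is not among them.
\<close>

subsection \<open>Total recursive functions\<close>

definition total_recursive :: "nat \<Rightarrow> (nat list \<Rightarrow> nat) \<Rightarrow> bool" where
  "total_recursive n h \<longleftrightarrow> partial_recursive n (\<lambda>xs. Some (h xs))"

lemma those_map_Some: "those (map (\<lambda>x. Some (f x)) xs) = Some (map f xs)"
  by (induction xs) auto

lemma total_recursive_nth: "i < n \<Longrightarrow> total_recursive n (\<lambda>xs. xs ! i)"
  unfolding total_recursive_def by (rule partial_recursive.proj)

text \<open>The outer function may be partial: it only has to converge on the tuples that the inner
  functions produce. This is what later allows a ranking function, possibly undefined outside the
  set, inside a total procedure.\<close>

lemma total_recursive_comp:
  assumes "partial_recursive (length hs) f" "\<forall>h\<in>set hs. total_recursive n h"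
    and "\<And>xs. length xs = n \<Longrightarrow> f (map (\<lambda>h. h xs) hs) = Some (k xs)"
  shows "total_recursive n k"
proof -
  let ?gs = "map (\<lambda>h xs. Some (h xs)) hs"
  have "partial_recursive n (comp_op f ?gs)"
    using assms(1,2) by (intro partial_recursive.comp) (auto simp: total_recursive_def)
  then show ?thesis
    unfolding total_recursive_def
    by (rule partial_recursive.ext) (simp add: comp_op_def comp_def those_map_Some assms(3))
qed

lemma total_recursive_comp1:
  assumes "total_recursive 1 (\<lambda>xs. f (xs ! 0))" "total_recursive n a"
  shows "total_recursive n (\<lambda>xs. f (a xs))"
  using assms
  by (intro total_recursive_comp[of "[a]" "\<lambda>xs. Some (f (xs ! 0))"]) (auto simp: total_recursive_def)

lemma total_recursive_comp2:
  assumes "total_recursive 2 (\<lambda>xs. f (xs ! 0) (xs ! 1))" "total_recursive n a" "total_recursive n b"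
  shows "total_recursive n (\<lambda>xs. f (a xs) (b xs))"
  using assms
  by (intro total_recursive_comp[of "[a, b]" "\<lambda>xs. Some (f (xs ! 0) (xs ! 1))"])
    (auto simp: total_recursive_def numeral_2_eq_2)

lemma total_recursive_Suc:
  assumes "total_recursive n a"
  shows "total_recursive n (\<lambda>xs. Suc (a xs))"
  using assms partial_recursive.succ
  by (intro total_recursive_comp[of "[a]" "\<lambda>xs. Some (Suc (hd xs))"]) auto

lemma total_recursive_const: "total_recursive n (\<lambda>xs. c)"
proof (induction c)
  case 0
  show ?case unfolding total_recursive_def by (rule partial_recursive.zero)
next
  case (Suc c)
  then show ?case by (rule total_recursive_Suc)
qed

lemma total_recursive_rec_nat:
  assumes "total_recursive 1 (\<lambda>xs. f (xs ! 0))"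
    and "total_recursive 3 (\<lambda>xs. g (xs ! 0) (xs ! 1) (xs ! 2))"
  shows "total_recursive 2 (\<lambda>xs. rec_nat (f (xs ! 1)) (\<lambda>k r. g k r (xs ! 1)) (xs ! 0))"
proof -
  let ?f = "\<lambda>xs. Some (f (xs ! 0))" and ?g = "\<lambda>xs. Some (g (xs ! 0) (xs ! 1) (xs ! 2))"
  have rec: "partial_recursive 2 (\<lambda>xs. prim_op ?f ?g (hd xs) (tl xs))"
    using assms partial_recursive.prim[of 1 ?f ?g]
    by (simp add: total_recursive_def numeral_2_eq_2 numeral_3_eq_3)
  have eq: "prim_op ?f ?g k [y] = Some (rec_nat (f y) (\<lambda>k r. g k r y) k)" for k y
    by (induction k) auto
  show ?thesis
    unfolding total_recursive_def
    by (rule partial_recursive.ext[OF rec])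
      (auto simp: eq[simplified numeral_2_eq_2 One_nat_def] numeral_2_eq_2 length_Suc_conv)
qed

lemma total_recursive_add:
  assumes "total_recursive n a" "total_recursive n b"
  shows "total_recursive n (\<lambda>xs. a xs + b xs)"
proof (rule total_recursive_comp2[OF _ assms])
  have "rec_nat y (\<lambda>_ r. Suc r) k = k + y" for k y by (induction k) auto
  then show "total_recursive 2 (\<lambda>xs. xs ! 0 + xs ! 1)"
    using total_recursive_rec_nat[of "\<lambda>x. x" "\<lambda>_ r _. Suc r"]
    by (simp add: total_recursive_Suc total_recursive_nth)
qed

lemma total_recursive_diff:
  assumes "total_recursive n a" "total_recursive n b"
  shows "total_recursive n (\<lambda>xs. a xs - b xs)"
proof -
  \<comment> \<open>Predecessor: the recursion discards the previous value and returns the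
    counter.\<close>
  have "rec_nat 0 (\<lambda>k _. k) x = x - 1" for x :: nat by (cases x) auto
  then have "total_recursive 2 (\<lambda>xs. xs ! 0 - 1)"
    using total_recursive_rec_nat[of "\<lambda>_. 0" "\<lambda>k _ _. k"]
    by (simp add: total_recursive_const total_recursive_nth)
  then have pred: "total_recursive 3 (\<lambda>xs. xs ! 1 - 1)"
    using total_recursive_comp2[of "\<lambda>x _. x - 1" 3 "\<lambda>xs. xs ! 1" "\<lambda>xs. xs ! 1"]
    by (simp add: total_recursive_nth)
  \<comment> \<open>Recursion runs on the first argument, so the subtrahend comes first here; the
    final composition swaps the arguments back.\<close>
  have "rec_nat y (\<lambda>_ r. r - 1) k = y - k" for k y :: nat by (induction k) auto
  then have "total_recursive 2 (\<lambda>xs. xs ! 1 - xs ! 0)"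
    using total_recursive_rec_nat[of "\<lambda>x. x" "\<lambda>_ r _. r - 1"] pred
    by (simp add: total_recursive_nth)
  then show ?thesis
    using total_recursive_comp2[of "\<lambda>x y. y - x" n b a] assms by simp
qed

lemma total_recursive_sum_lessThan:
  assumes "total_recursive 2 (\<lambda>xs. h (xs ! 0) (xs ! 1))"
  shows "total_recursive 2 (\<lambda>xs. \<Sum>i<xs ! 0. h i (xs ! 1))"
proof -
  have "rec_nat 0 (\<lambda>k r. r + h k y) k = (\<Sum>i<k. h i y)" for k y by (induction k) auto
  moreover have "total_recursive 3 (\<lambda>xs. xs ! 1 + h (xs ! 0) (xs ! 2))"
    by (intro total_recursive_add total_recursive_comp2[OF assms] total_recursive_nth) auto
  ultimately show ?thesis
    using total_recursive_rec_nat[of "\<lambda>_. 0" "\<lambda>k r y. r + h k y"]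
    by (simp add: total_recursive_const)
qed

text \<open>For a total \<open>h\<close> the definedness condition of \<open>mu_op\<close> is
  automatic, so the search converges as soon as a zero exists.\<close>

lemma total_recursive_Least:
  assumes "total_recursive 2 (\<lambda>xs. h (xs ! 0) (xs ! 1))" "\<And>x. \<exists>y. h y x = 0"
  shows "total_recursive 1 (\<lambda>xs. LEAST y. h y (xs ! 0) = 0)"
proof -
  let ?h = "\<lambda>xs. Some (h (xs ! 0) (xs ! 1))"
  have "partial_recursive 1 (mu_op ?h)"
    using assms(1) by (intro partial_recursive.mu) (simp add: total_recursive_def numeral_2_eq_2)
  then show ?thesis
    unfolding total_recursive_def
    by (rule partial_recursive.ext) (simp add: mu_op_def assms(2))
qed


subsection \<open>The decision procedure on the natural numbers\<close>

lemma total_recursive_char_of_rankable: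
  assumes E: "total_recursive 1 (\<lambda>xs. E (xs ! 0))" "range E \<subseteq> S" "infinite (range E)"
    and C: "total_recursive 1 (\<lambda>xs. C (xs ! 0))" "range C = - S"
    and g: "partial_recursive 1 g" "\<And>n. n \<in> S \<Longrightarrow> g [n] = Some (card {m \<in> S. m < n})"
  shows "total_recursive 1 (\<lambda>xs. if xs ! 0 \<in> S then 2 else 1)"
proof -
  note intros = total_recursive_add total_recursive_diff total_recursive_nth total_recursive_const
    total_recursive_Suc

  \<comment> \<open>Truncated subtraction turns the test \<open>x < E n\<close> into an equation
    with 0, as unbounded search requires. It succeeds since \<open>range E\<close> is
    infinite.\<close>
  define bound where "bound x = E (LEAST n. Suc x - E n = 0)" for x
  have ex_large: "\<exists>n. Suc x - E n = 0" for x
    using E(3) by (auto simp: finite_nat_set_iff_bounded_le not_le Suc_le_eq)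
  have bound_gt: "x < bound x" for x
    using LeastI_ex[OF ex_large[of x]] by (simp add: bound_def)
  have bound_in: "bound x \<in> S" for x using E(2) by (auto simp: bound_def)
  have bound: "total_recursive 1 (\<lambda>xs. bound (xs ! 0))"
    unfolding bound_def
    by (intro total_recursive_comp1[OF E(1)] total_recursive_Least intros ex_large) auto

  define rank where "rank x = card {m \<in> S. m < bound x}" for x
  have rank: "total_recursive 1 (\<lambda>xs. rank (xs ! 0))"
    using bound g bound_in
    by (intro total_recursive_comp[of "[\<lambda>xs. bound (xs ! 0)]" g]) (auto simp: rank_def)

  \<comment> \<open>The two truncated differences add up to the distance of \<open>C s\<close> and
    \<open>y\<close>, so each summand is 1 if they agree and 0 otherwise.\<close>
  define hits where "hits t y = (\<Sum>s<t. 1 - ((C s - y) + (y - C s)))" for t y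
  have hits_pos: "0 < hits t y \<longleftrightarrow> (\<exists>s<t. C s = y)" for t y
  proof -
    have "1 - ((a - b) + (b - a)) = (if a = b then 1 else 0)" for a b :: nat by auto
    then show ?thesis by (auto simp: hits_def simp flip: neq0_conv)
  qed
  have "total_recursive 2 (\<lambda>xs. hits (xs ! 0) (xs ! 1))"
    unfolding hits_def
    by (intro total_recursive_sum_lessThan intros total_recursive_comp1[OF C(1)]) auto
  note hits = total_recursive_comp2[OF this]

  \<comment> \<open>The double subtraction caps \<open>hits\<close> at 1, so a number that
    \<open>C\<close> repeats is counted once.\<close>
  define found where "found b t = (\<Sum>y<b. 1 - (1 - hits t y))" for b t
  have found_eq: "found b t = card {y. y < b \<and> (\<exists>s<t. C s = y)}" for b t
  proof -
    have "found b t = (\<Sum>y<b. if \<exists>s<t. C s = y then 1 else 0)"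
      unfolding found_def using hits_pos by (intro sum.cong) (auto simp: Suc_le_eq)
    also have "\<dots> = card {y \<in> {..<b}. \<exists>s<t. C s = y}"
      by (subst sum.inter_filter[symmetric]) auto
    finally show ?thesis by simp
  qed
  have "total_recursive 2 (\<lambda>xs. found (xs ! 0) (xs ! 1))"
    unfolding found_def by (intro total_recursive_sum_lessThan intros hits) auto
  note found = total_recursive_comp2[OF this]

  have card_compl: "card {y. y < b \<and> y \<notin> S} = b - card {m \<in> S. m < b}" for b
  proof -
    have "{y. y < b \<and> y \<notin> S} = {..<b} - {m \<in> S. m < b}" by auto
    then show ?thesis by (simp add: card_Diff_subset subset_iff)
  qed

  \<comment> \<open>The search stops once the members of \<open>S\<close> below the bound and the
    non-members found so far account for all \<open>bound x\<close> numbers.\<close>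
  define time where "time x = (LEAST t. bound x - (rank x + found (bound x) t) = 0)" for x
  have ex_time: "\<exists>t. bound x - (rank x + found (bound x) t) = 0" for x
  proof -
    let ?N = "{y. y < bound x \<and> y \<notin> S}"
    have "\<forall>y\<in>?N. \<exists>s. C s = y" using C(2) by (metis (no_types, lifting) ComplI imageE mem_Collect_eq)
    then obtain s where s: "\<forall>y\<in>?N. C (s y) = y" by metis
    \<comment> \<open>Only finitely many non-members lie below the bound, so one stage exceeds all
      the chosen indices.\<close>
    obtain t where "\<forall>y\<in>?N. s y < t"
      using finite_nat_set_iff_bounded[of "s ` ?N"] by auto
    with s have "?N \<subseteq> {y. y < bound x \<and> (\<exists>s<t. C s = y)}" by auto
    then have "card ?N \<le> found (bound x) t" unfolding found_eq by (intro card_mono) auto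
    then show ?thesis using card_compl[of "bound x"] by (auto simp: rank_def intro!: exI[of _ t])
  qed
  have time: "total_recursive 1 (\<lambda>xs. time (xs ! 0))"
    unfolding time_def
    by (intro total_recursive_Least intros found total_recursive_comp1[OF bound]
        total_recursive_comp1[OF rank] ex_time) auto

  have decide: "(if x \<in> S then 2 else 1) = Suc (1 - hits (time x) x)" for x
  proof -
    let ?H = "{y. y < bound x \<and> (\<exists>s<time x. C s = y)}" and ?N = "{y. y < bound x \<and> y \<notin> S}"
    have "?H \<subseteq> ?N" using C(2) by blast
    moreover have "card ?N \<le> card ?H"
      using LeastI_ex[OF ex_time[of x]] unfolding time_def[symmetric]
      by (simp add: card_compl found_eq rank_def)
    \<comment> \<open>A subset of a finite set with at least as many elements is the whole set.
      Since \<open>x\<close> lies below the bound, not having been enumerated by now proves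
      membership in \<open>S\<close>.\<close>
    ultimately have "?H = ?N" by (intro card_seteq) auto
    then have "(\<exists>s<time x. C s = x) \<longleftrightarrow> x \<notin> S" using bound_gt[of x] by blast
    then show ?thesis using hits_pos[of "time x" x] by auto
  qed
  show ?thesis unfolding decide by (intro intros hits time) auto
qed


subsection \<open>Transfer to strings\<close>

lemma total_in_F_PR_iff:
  "(\<lambda>w. Some (e w)) \<in> F_PR \<longleftrightarrow>
    total_recursive 1 (\<lambda>xs. str_code (e (inv str_code (xs ! 0))))"
  (is "_ \<longleftrightarrow> total_recursive 1 ?h")
proof
  assume "(\<lambda>w. Some (e w)) \<in> F_PR"
  then obtain g where g: "partial_recursive 1 g" "\<And>w. g [str_code w] = Some (str_code (e w))"
    by (auto simp: F_PR_def)
  have "Some (?h xs) = g xs" if "length xs = 1" for xs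
    using that g(2)[of "inv str_code (xs ! 0)"]
    by (auto simp: length_Suc_conv surj_f_inv_f[OF surj_str_code])
  with g(1) show "total_recursive 1 ?h"
    unfolding total_recursive_def by (rule partial_recursive.ext)
next
  assume "total_recursive 1 ?h"
  then show "(\<lambda>w. Some (e w)) \<in> F_PR"
    unfolding F_PR_def total_recursive_def
    by (auto intro!: exI[of _ "\<lambda>xs. Some (?h xs)"] simp: inv_f_f[OF inj_str_code])
qed

lemma re_set_enumeration:
  assumes "re_set B" "B \<noteq> {}"
  obtains E where "total_recursive 1 (\<lambda>xs. E (xs ! 0))" "range E = str_code ` B"
proof -
  obtain e where e: "(\<lambda>w. Some (e w)) \<in> F_PR" "B = range e"
    using assms by (auto simp: re_set_def)
  have "range (\<lambda>n. str_code (e (inv str_code n))) = str_code ` e ` range (inv str_code)"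
    by auto
  also have "\<dots> = str_code ` B"
    by (simp add: e(2) surj_imp_inj_inv inj_imp_surj_inv inj_str_code)
  finally show ?thesis using that e(1) by (simp add: total_in_F_PR_iff)
qed

lemma card_le_str: "card {y \<in> A. y \<le> x} = card {n \<in> str_code ` A. n \<le> str_code x}"
proof -
  have "{n \<in> str_code ` A. n \<le> str_code x} = str_code ` {y \<in> A. y \<le> x}"
    using str_code_less_iff by (auto simp flip: not_less)
  then show ?thesis using inj_str_code by (simp add: card_image inj_on_subset)
qed

text \<open>Ranks count from 1 and codes from 0: the string of rank i has code i - 1, and the
  element dropped from the count is \<open>x\<close> itself.\<close>

lemma ranking_function_code:
  assumes "ranking_function f A" "x \<in> A"
  shows "map_option str_code (f x) = Some (card {n \<in> str_code ` A. n < str_code x})"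
proof -
  obtain w where w: "f x = Some w"
    using assms by (auto simp: ranking_function_def)
  have "card {y. y \<le> w} = card {y \<in> A. y \<le> x}"
    using assms w by (fastforce simp: ranking_function_def is_nth_elem_def)
  moreover have "card {y. y \<le> w} = Suc (str_code w)"
    using card_le_str[of UNIV w] by (simp add: surj_str_code flip: atMost_def)
  moreover have "{n \<in> str_code ` A. n \<le> str_code x}
      = insert (str_code x) {n \<in> str_code ` A. n < str_code x}"
    using assms(2) by auto
  ultimately show ?thesis using w by (simp add: card_le_str)
qed

theorem theorem12:
  fixes A :: "str set"
  assumes "rankable F_PR A"
    and "co_re_set A"
    and "\<exists>B. B \<subseteq> A \<and> infinite B \<and> re_set B"
  shows "recursive_set A"
proof -
  have "total_recursive 1 (\<lambda>xs. if xs ! 0 \<in> str_code ` A then 2 else 1)"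
  \<comment> \<open>An empty complement is r.e. without having an enumeration, so this case is
    settled directly.\<close>
  proof (cases "A = UNIV")
    case True
    then show ?thesis by (simp add: surj_str_code total_recursive_const)
  next
    case False
    then have "- A \<noteq> {}" by auto
    with assms(2) obtain C
      where C: "total_recursive 1 (\<lambda>xs. C (xs ! 0))" "range C = str_code ` (- A)"
      unfolding co_re_set_def by (rule re_set_enumeration)
    obtain B where B: "B \<subseteq> A" "infinite B" "re_set B" using assms(3) by blast
    then have "B \<noteq> {}" by auto
    with B(3) obtain E
      where E: "total_recursive 1 (\<lambda>xs. E (xs ! 0))" "range E = str_code ` B"
      by (rule re_set_enumeration)
    obtain f g where f: "ranking_function f A" and g: "partial_recursive 1 g"
      "\<And>w. map_option str_code (f w) = g [str_code w]"
      using assms(1) by (auto simp: rankable_def F_PR_def)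
    show ?thesis
    proof (rule total_recursive_char_of_rankable[OF E(1) _ _ C(1) _ g(1)])
      show "range E \<subseteq> str_code ` A" using B(1) E(2) by auto
      show "infinite (range E)"
        using B(2) E(2) inj_str_code by (simp add: finite_image_iff inj_on_subset)
      show "range C = - str_code ` A"
        using C(2) inj_str_code surj_str_code by (simp add: bij_image_Compl_eq bij_def)
      show "g [n] = Some (card {m \<in> str_code ` A. m < n})" if "n \<in> str_code ` A" for n
        using that ranking_function_code[OF f] g(2) by auto
    qed
  qed
  moreover have "inv str_code n \<in> A \<longleftrightarrow> n \<in> str_code ` A" for n
    using inj_image_mem_iff[OF inj_str_code, of "inv str_code n" A]
    by (simp add: surj_f_inv_f[OF surj_str_code])
  ultimately show ?thesis
    unfolding recursive_set_def total_in_F_PR_iff by (simp add: if_distrib[of str_code] cong: if_cong)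
qed

end
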